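(* Let $n\ge 2$ and let $M\in\mathbb{Z}^{n\times n}$ be similar to $J_n$. Then there exists a digit set $\mathcal{D}\subset\mathbb{Z}^n$ of size $n$ such that $(M,\mathcal{D})$ is a full number system. Moreover, this bound is tight: for each $n\ge 2$ there exists $M\in\mathbb{Z}^{n\times n}$ similar to $J_n$ such that for every digit set $\mathcal{D}\subset\mathbb{Z}^n$ with fewer than $n$ elements, $(M,\mathcal{D})$ is not a full number system.
   Context: $J_n$ denotes the $n\times n$ Jordan block with eigenvalue $1$: the matrix with $1$'s on the diagonal and on the superdiagonal and $0$'s elsewhere. Similarity is over $\mathbb{Q}$: $M=P^{-1}J_nP$ for some invertible rational matrix $P$ (which may be taken to have integer entries, but need not be unimodular). For $M\in\mathbb{Z}^{n\times n}$ and a finite set $\mathcal{D}\subset\mathbb{Z}^n$ (the digit set), a vector $v\in\mathbb{Z}^n$ has a representation in base $M$ with digit set $\mathcal{D}$ if there is a finite nonempty sequence $a_k,a_{k-1},\dots,a_0$ of elements of $\mathcal{D}$ with $v=M^ka_k+\dots+M a_1+a_0$. The pair $(M,\mathcal{D})$ is a full number system if every $v\in\mathbb{Z}^n$ has such a representation. *)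

theory Defs
  imports "Jordan_Normal_Form.Jordan_Normal_Form"
begin

definition digit_set :: "nat \<Rightarrow> int vec set \<Rightarrow> bool" where
  "digit_set n D \<longleftrightarrow> finite D \<and> D \<subseteq> carrier_vec n"

text \<open>
  The digits are \<open>a 0, \<dots>, a k\<close> (so at least one digit is used); the values of \<open>a\<close> beyond
  \<open>k\<close> are irrelevant.
\<close>
definition has_representation :: "nat \<Rightarrow> int mat \<Rightarrow> int vec set \<Rightarrow> int vec \<Rightarrow> bool" where
  "has_representation n M D v \<longleftrightarrow>
     (\<exists>k a. (\<forall>i\<le>k. a i \<in> D) \<and>
        v = finsum_vec TYPE(int) n (\<lambda>i. (M ^\<^sub>m i) *\<^sub>v a i) {..k::nat})"

definition full_number_system :: "nat \<Rightarrow> int mat \<Rightarrow> int vec set \<Rightarrow> bool" where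
  "full_number_system n M D \<longleftrightarrow> (\<forall>v \<in> carrier_vec n. has_representation n M D v)"

definition rat_similar_to_jordan :: "nat \<Rightarrow> int mat \<Rightarrow> bool" where
  "rat_similar_to_jordan n M \<longleftrightarrow>
     similar_mat (map_mat rat_of_int M) (jordan_block n (1 :: rat))"

end

theory Submission
  imports Defs "HOL-Library.Function_Algebras"
begin

text \<open>
  Write \<open>M = 1 + N\<close> and let \<open>V j\<close> be the kernel of \<open>N ^ j\<close> in \<open>\<int> ^ n\<close>, so that
  \<open>V (j + 1) / V j \<cong> \<int>\<close> with \<open>M\<close> acting trivially. By descending induction on \<open>j\<close> there are
  \<open>n - j\<close> digits representing every vector modulo \<open>V j\<close>. To pass from \<open>V (j + 1)\<close> to \<open>V j\<close>
  it suffices to find words with value in \<open>V (j + 1)\<close> whose images in \<open>\<int>\<close> are \<open>1\<close> and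
  negative, because such words can be appended to any representation. Two Thue--Morse words in two
  digits with different top coordinates have the same digit counts, but values that agree modulo
  \<open>V (j + 1)\<close> and not modulo \<open>V j\<close>; this yields a word with value in \<open>V (j + 1)\<close> whose image
  is not divisible by the number of occurrences of some digit \<open>d\<close>. Replacing \<open>d\<close> by two
  translates whose images in \<open>\<int>\<close> are consecutive then produces the images \<open>1\<close> and \<open>- 1\<close>. The
  induction starts at \<open>j = n - 2\<close> with two explicit digits. For tightness take \<open>N\<close> divisible by
  \<open>2\<close>: modulo \<open>2\<close> a represented vector is the sum of a subset of the digits, and all \<open>2 ^ n\<close>
  classes must occur.
\<close>

subsection \<open>Words over a digit set\<close>

lemma additive_funpow:
  fixes f :: "'a::ab_group_add \<Rightarrow> 'a"
  assumes "additive f"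
  shows "additive (f ^^ k)"
proof -
  interpret additive f by fact
  show ?thesis
    by (induction k) (auto simp: additive_def add)
qed

lemma int_subgroup_principal:
  fixes H :: "int set"
  assumes diff: "\<And>x y. x \<in> H \<Longrightarrow> y \<in> H \<Longrightarrow> x - y \<in> H"
    and nz: "h \<in> H" "h \<noteq> 0"
  shows "\<exists>t>0. H = range (\<lambda>z. t * z)"
proof -
  have zero: "0 \<in> H" using diff[OF nz(1) nz(1)] by simp
  have neg: "- x \<in> H" if "x \<in> H" for x using diff[OF zero that] by simp
  have add: "x + y \<in> H" if "x \<in> H" "y \<in> H" for x y using diff[OF that(1) neg[OF that(2)]] by simp
  define P where "P k \<longleftrightarrow> 0 < k \<and> int k \<in> H" for k :: nat
  have "P (nat \<bar>h\<bar>)" using nz neg by (auto simp: P_def abs_if)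
  then have "P (LEAST k. P k)" by (rule LeastI)
  moreover define t where "t = int (LEAST k. P k)"
  ultimately have t: "t > 0" "t \<in> H" by (auto simp: P_def)
  have nat_mult: "t * int k \<in> H" for k
    by (induction k) (use zero add t in \<open>auto simp: algebra_simps\<close>)
  have mult: "t * z \<in> H" for z
  proof (cases "z \<ge> 0")
    case True then show ?thesis using nat_mult[of "nat z"] by simp
  next
    case False then show ?thesis using neg[OF nat_mult[of "nat (- z)"]] by simp
  qed
  have "x \<in> range (\<lambda>z. t * z)" if "x \<in> H" for x
  proof -
    have "x mod t = x - t * (x div t)" by (simp add: minus_mult_div_eq_mod)
    then have m: "x mod t \<in> H" using diff[OF that mult] by simp
    have "x mod t = 0"
    proof (rule ccontr)
      assume "x mod t \<noteq> 0"
      then have "0 < x mod t" using t pos_mod_sign[of t x] by linarith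
      then have "P (nat (x mod t))" using m by (simp add: P_def)
      then have "(LEAST k. P k) \<le> nat (x mod t)" by (rule Least_le)
      then show False using pos_mod_bound[OF t(1), of x] \<open>0 < x mod t\<close> by (simp add: t_def)
    qed
    then show ?thesis by (metis dvd_def mod_eq_0_iff_dvd rangeI)
  qed
  then show ?thesis using t mult by auto
qed

text \<open>Horner form with the lowest digit at the head: appending on the right adds terms with
  higher powers of \<open>M\<close> and keeps the digits already chosen.\<close>

primrec word_value :: "('a::ab_group_add \<Rightarrow> 'a) \<Rightarrow> 'a list \<Rightarrow> 'a" where
  "word_value M [] = 0"
| "word_value M (d # w) = d + M (word_value M w)"

text \<open>Representability modulo \<open>U\<close>. Words are nonempty because a representation
  uses at least one digit.\<close>

definition covers :: "('a::ab_group_add \<Rightarrow> 'a) \<Rightarrow> 'a set \<Rightarrow> 'a set \<Rightarrow> 'a set \<Rightarrow> bool" where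
  "covers M A D U \<longleftrightarrow> (\<forall>v\<in>A. \<exists>w. w \<noteq> [] \<and> set w \<subseteq> D \<and> word_value M w - v \<in> U)"

lemma word_value_append:
  assumes "additive M"
  shows "word_value M (u @ w) = word_value M u + (M ^^ length u) (word_value M w)"
proof -
  interpret additive M by fact
  show ?thesis by (induction u) (simp_all add: add add.assoc)
qed

text \<open>One step of the filtration: \<open>U\<close> will be \<open>V (Suc i)\<close> and
  \<open>\<phi>\<close> the projection of \<open>V (Suc i) / V i\<close> onto the integers, where
  \<open>M\<close> acts trivially.\<close>

locale layer = additive M for M :: "'a::ab_group_add \<Rightarrow> 'a" +
  fixes U :: "'a set" and \<phi> :: "'a \<Rightarrow> int"
  assumes U_zero: "0 \<in> U"
    and U_add: "x \<in> U \<Longrightarrow> y \<in> U \<Longrightarrow> x + y \<in> U"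
    and M_U: "x \<in> U \<Longrightarrow> M x \<in> U"
    and phi_add: "x \<in> U \<Longrightarrow> y \<in> U \<Longrightarrow> \<phi> (x + y) = \<phi> x + \<phi> y"
    and phi_M: "x \<in> U \<Longrightarrow> \<phi> (M x) = \<phi> x"
begin

abbreviation val where "val \<equiv> word_value M"

text \<open>Powers of \<open>M\<close> preserve \<open>U\<close> and \<open>\<phi>\<close>, so
  appending a loop to any word changes its value by an element of \<open>U\<close> on which
  \<open>\<phi>\<close> is \<open>z\<close>, whatever the length of the word.\<close>

definition loop :: "'a set \<Rightarrow> int \<Rightarrow> 'a list \<Rightarrow> bool" where
  "loop D z w \<longleftrightarrow> set w \<subseteq> D \<and> val w \<in> U \<and> \<phi> (val w) = z"

lemma phi_zero: "\<phi> 0 = 0"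
  using phi_add[OF U_zero U_zero] by simp

lemma funpow_M:
  assumes "x \<in> U" shows "(M ^^ k) x \<in> U" "\<phi> ((M ^^ k) x) = \<phi> x"
proof -
  have "(M ^^ k) x \<in> U \<and> \<phi> ((M ^^ k) x) = \<phi> x"
    by (induction k) (use assms in \<open>auto simp: M_U phi_M\<close>)
  then show "(M ^^ k) x \<in> U" "\<phi> ((M ^^ k) x) = \<phi> x" by auto
qed

lemma val_append: "val (u @ w) = val u + (M ^^ length u) (val w)"
  by (rule word_value_append) (rule additive_axioms)

lemma loop_Nil: "loop D 0 []"
  by (simp add: loop_def U_zero phi_zero)

lemma loop_append:
  assumes "loop D y u" "loop D z w"
  shows "loop D (y + z) (u @ w)"
  using assms by (auto simp: loop_def val_append U_add funpow_M phi_add)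

lemma loop_power:
  assumes "loop D z w"
  shows "loop D (int k * z) (concat (replicate k w))"
proof (induction k)
  case (Suc k)
  show ?case using loop_append[OF assms Suc] by (simp add: algebra_simps)
qed (simp add: loop_Nil)

text \<open>As \<open>z \<le> - 1\<close>, \<open>\<bar>s\<bar>\<close> copies of the negative loop
  reach a value at most \<open>s\<close>; copies of \<open>u\<close> make up the difference.\<close>

lemma loop_all:
  assumes one: "loop D 1 u" and neg: "loop D z w" "z < 0"
  shows "\<exists>w. loop D s w"
proof -
  have nonneg: "\<exists>w. loop D s w" if "s \<ge> 0" for s
    using loop_power[OF one, of "nat s"] that by auto
  have "z * \<bar>s\<bar> \<le> (- 1) * \<bar>s\<bar>" using neg(2) by (intro mult_right_mono) auto
  then have "s - int (nat \<bar>s\<bar>) * z \<ge> 0" by (simp add: algebra_simps)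
  from nonneg[OF this] obtain w' where "loop D (s - int (nat \<bar>s\<bar>) * z) w'" by blast
  from loop_append[OF loop_power[OF neg(1), of "nat \<bar>s\<bar>"] this] show ?thesis by auto
qed

text \<open>The error of a representation modulo \<open>U\<close> lies in \<open>U\<close>; an
  appended loop of opposite \<open>\<phi>\<close>-value cancels its image.\<close>

lemma covers_kernel:
  assumes cov: "covers M A D U"
    and loops: "loop D 1 u" "loop D z u'" "z < 0"
  shows "covers M A D {x \<in> U. \<phi> x = 0}"
  unfolding covers_def
proof
  fix v assume "v \<in> A"
  then obtain w where w: "w \<noteq> []" "set w \<subseteq> D" "val w - v \<in> U"
    using cov by (auto simp: covers_def)
  obtain l where l: "loop D (- \<phi> (val w - v)) l" using loop_all[OF loops] by blast
  then have l': "set l \<subseteq> D" "val l \<in> U" "\<phi> (val l) = - \<phi> (val w - v)"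
    by (auto simp: loop_def)
  have eq: "val (w @ l) - v = (val w - v) + (M ^^ length w) (val l)"
    by (simp add: val_append algebra_simps)
  have "val (w @ l) - v \<in> {x \<in> U. \<phi> x = 0}"
    unfolding eq using w l' by (simp add: U_add phi_add funpow_M)
  then show "\<exists>w. w \<noteq> [] \<and> set w \<subseteq> D \<and> val w - v \<in> {x \<in> U. \<phi> x = 0}"
    using w(1,2) l'(1) by (intro exI[of _ "w @ l"]) auto
qed

text \<open>Each occurrence of \<open>d\<close> becomes \<open>d + e\<close> or
  \<open>d + e'\<close>, raising the \<open>\<phi>\<close>-value by \<open>c\<close> or
  \<open>c + 1\<close> at any position, because \<open>\<phi>\<close> is \<open>M\<close>-invariant
  on \<open>U\<close>. Here \<open>r\<close> occurrences receive \<open>e'\<close>.\<close>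

lemma recolour:
  assumes e: "e \<in> U" "\<phi> e = c" "e' \<in> U" "\<phi> e' = c + 1"
    and "set w \<subseteq> D" "r \<le> count_list w d"
  shows "\<exists>w'. set w' \<subseteq> insert (d + e) (insert (d + e') (D - {d})) \<and> length w' = length w \<and>
           val w' - val w \<in> U \<and> \<phi> (val w' - val w) = c * int (count_list w d) + int r"
    (is "\<exists>w'. ?P w r w'")
  using assms(5,6)
proof (induction w arbitrary: r)
  case Nil
  then show ?case by (simp add: U_zero phi_zero)
next
  case (Cons x w)
  \<comment> \<open>Treats all cases for the head at once: \<open>f\<close> is \<open>0\<close>,
    \<open>e\<close> or \<open>e'\<close>, and \<open>k\<close> tells whether an \<open>e'\<close>
    is spent.\<close>
  have ext: "?P (x # w) (r + k) ((x + f) # w')"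
    if "?P w r w'" "f \<in> U" "x + f \<in> insert (d + e) (insert (d + e') (D - {d}))"
      "\<phi> f = c * (if x = d then 1 else 0) + int k" for f w' r k
  proof -
    have eq: "val ((x + f) # w') - val (x # w) = f + M (val w' - val w)"
      by (simp add: diff algebra_simps)
    show ?thesis unfolding eq using that by (simp add: U_add M_U phi_M phi_add algebra_simps)
  qed
  have IH: "\<exists>w'. ?P w r w'" if "r \<le> count_list w d" for r
    using Cons.IH[OF _ that] Cons.prems(1) by simp
  show ?case
  proof (cases "x = d")
    case False
    then have "r \<le> count_list w d" using Cons.prems by simp
    from IH[OF this] obtain w' where "?P w r w'" by blast
    from ext[OF this U_zero, of 0] have "?P (x # w) r ((x + 0) # w')"
      using False Cons.prems phi_zero by simp
    then show ?thesis by (rule exI)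
  next
    case True
    show ?thesis
    proof (cases "r \<le> count_list w d")
      case le: True
      from IH[OF this] obtain w' where "?P w r w'" by blast
      from ext[OF this e(1), of 0] have "?P (x # w) r ((x + e) # w')"
        using True e(2) by simp
      then show ?thesis by (rule exI)
    next
      case False
      then obtain r' where r: "r = r' + 1" "r' \<le> count_list w d"
        using Cons.prems True by (cases r) auto
      from IH[OF r(2)] obtain w' where "?P w r' w'" by blast
      from ext[OF this e(3), of 1] have "?P (x # w) r ((x + e') # w')"
        using True e(4) r by simp
      then show ?thesis by (rule exI)
    qed
  qed
qed

lemma count_list_power: "count_list (concat (replicate k w)) d = k * count_list w d"
  by (induction k) auto

text \<open>With \<open>k = z' - z\<close> copies of \<open>w\<close> before \<open>w'\<close>, the
  count of \<open>d\<close> is a multiple of \<open>k + 1\<close>, whereas the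
  \<open>\<phi>\<close>-value is \<open>(k + 1) * z + k\<close>, which is not.\<close>

lemma loop_not_dvd_count:
  assumes "loop D z w" "loop D z' w'" "z < z'"
    and "count_list w' d = count_list w d" "d \<in> set w'"
  shows "\<exists>y u. loop D y u \<and> d \<in> set u \<and> \<not> int (count_list u d) dvd y"
proof -
  define k where "k = nat (z' - z)"
  let ?u = "concat (replicate k w) @ w'"
  have k: "int k = z' - z" "k > 0" using assms(3) by (auto simp: k_def)
  have "loop D (int k * z + z') ?u" by (intro loop_append loop_power assms)
  moreover have "\<not> int (count_list ?u d) dvd int k * z + z'"
  proof
    assume *: "int (count_list ?u d) dvd int k * z + z'"
    have "int (count_list ?u d) = (int k + 1) * int (count_list w d)"
      by (simp add: count_list_power assms(4) algebra_simps)
    then have "int k + 1 dvd int k * z + z'" using * by (metis dvd_mult_left)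
    also have "int k * z + z' = (int k + 1) * z + int k" using k by (simp add: algebra_simps)
    finally have "int k + 1 dvd int k" by (simp add: dvd_add_right_iff)
    then show False using k zdvd_imp_le by fastforce
  qed
  moreover have "d \<in> set ?u" using assms(5) by simp
  ultimately show ?thesis by blast
qed

text \<open>
  Shifting all digits \<open>d\<close> in the loop \<open>u\<close> by \<open>c\<close> brings its \<open>\<phi>\<close>-value strictly between
  \<open>- m\<close> and \<open>0\<close>, where \<open>m\<close> counts the occurrences of \<open>d\<close>; shifting some of them by \<open>c + 1\<close>
  instead yields both values \<open>1\<close> and \<open>- 1\<close>.
\<close>
lemma covers_split_digit:
  assumes cov: "covers M A D U"
    and onto: "\<And>z. \<exists>x\<in>U. \<phi> x = z"
    and u: "loop D y u" "\<not> int (count_list u d) dvd y" "d \<in> set u"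
  shows "\<exists>e\<in>U. \<exists>e'\<in>U. covers M A (insert (d + e) (insert (d + e') (D - {d}))) {x \<in> U. \<phi> x = 0}"
proof -
  define m where "m = int (count_list u d)"
  have m: "m > 0" using u(3) count_list_0_iff[of u d] by (auto simp: m_def)
  define c where "c = - (y div m) - 1"
  have r: "0 < y mod m" "y mod m < m"
    using m u(2) pos_mod_sign[of m y] by (auto simp: m_def dvd_eq_mod_eq_0 order_le_less)
  have shift: "y + c * m = y mod m - m"
    by (simp add: c_def algebra_simps minus_mult_div_eq_mod [symmetric])
  obtain e e' where e: "e \<in> U" "\<phi> e = c" "e' \<in> U" "\<phi> e' = c + 1" using onto by blast
  let ?D = "insert (d + e) (insert (d + e') (D - {d}))"
  have loops: "\<exists>w. loop ?D z w" if "z = 1 \<or> z = - 1" for z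
  proof -
    \<comment> \<open>With \<open>r\<close> shifts by \<open>c + 1\<close> the value becomes
      \<open>y mod m - m + r\<close>. Since \<open>0 < y mod m < m\<close>, both targets
      \<open>1\<close> and \<open>- 1\<close> give \<open>0 \<le> r \<le> m\<close>.\<close>
    define r where "r = nat (z + m - y mod m)"
    have r': "int r = z + m - y mod m" "r \<le> count_list u d"
      using that r by (auto simp: r_def m_def)
    obtain w where w: "set w \<subseteq> ?D" "val w - val u \<in> U"
      "\<phi> (val w - val u) = c * int (count_list u d) + int r"
      using recolour[OF e _ r'(2)] u(1) unfolding loop_def by blast
    have eq: "val w = val u + (val w - val u)" by simp
    have "val w \<in> U" using w(2) u(1) U_add[of "val u" "val w - val u"] by (auto simp: loop_def)
    moreover have "\<phi> (val w) = y + (c * m + int r)"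
      using w u(1) phi_add[of "val u" "val w - val u"] by (simp add: loop_def m_def)
    ultimately have "loop ?D z w" using w(1) shift r'(1) by (simp add: loop_def)
    then show ?thesis by blast
  qed
  have "covers M A ?D U"
    unfolding covers_def
  proof
    fix v assume "v \<in> A"
    then obtain w where w: "w \<noteq> []" "set w \<subseteq> D" "val w - v \<in> U"
      using cov by (auto simp: covers_def)
    then obtain w' where w': "set w' \<subseteq> ?D" "length w' = length w" "val w' - val w \<in> U"
      using recolour[OF e w(2), of 0] by blast
    have "val w' - v \<in> U" using U_add[OF w'(3) w(3)] by simp
    then show "\<exists>w. w \<noteq> [] \<and> set w \<subseteq> ?D \<and> val w - v \<in> U"
      using w' w(1) by (intro exI[of _ w']) auto
  qed
  then have "covers M A ?D {x \<in> U. \<phi> x = 0}"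
    using loops[of 1] loops[of "- 1"] covers_kernel[of A ?D] by fastforce
  then show ?thesis using e by blast
qed

end

subsection \<open>Unipotent operators on a lattice\<close>

text \<open>Coordinate-free form of a single Jordan block: \<open>\<psi>\<close> embeds the kernel
  of \<open>N\<close> in the integers, and \<open>N\<close> has nilpotency index exactly
  \<open>n\<close>.\<close>

locale unipotent_lattice =
  fixes A :: "'a::ab_group_add set" and N :: "'a \<Rightarrow> 'a" and \<psi> :: "'a \<Rightarrow> int" and n :: nat
  assumes n: "2 \<le> n"
    and N_additive: "additive N"
    and psi_additive: "additive \<psi>"
    and A_zero: "0 \<in> A"
    and A_add: "x \<in> A \<Longrightarrow> y \<in> A \<Longrightarrow> x + y \<in> A"
    and A_uminus: "x \<in> A \<Longrightarrow> - x \<in> A"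
    and N_A: "x \<in> A \<Longrightarrow> N x \<in> A"
    and N_nilpotent: "x \<in> A \<Longrightarrow> (N ^^ n) x = 0"
    and psi_inj: "x \<in> A \<Longrightarrow> N x = 0 \<Longrightarrow> \<psi> x = 0 \<Longrightarrow> x = 0"
    and N_index: "\<exists>x\<in>A. (N ^^ (n - 1)) x \<noteq> 0"
begin

sublocale N: additive N by (rule N_additive)
sublocale psi: additive \<psi> by (rule psi_additive)
sublocale Npow: additive "N ^^ k" for k by (rule additive_funpow) (rule N_additive)

definition M where "M x = x + N x"

sublocale M: additive M
  by unfold_locales (simp add: M_def N.add)

definition V where "V j = {x \<in> A. (N ^^ j) x = 0}"

lemma V_n: "V n = A"
  using N_nilpotent by (auto simp: V_def)

lemma A_diff: "x \<in> A \<Longrightarrow> y \<in> A \<Longrightarrow> x - y \<in> A"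
  using A_add[OF _ A_uminus, of x y] by simp

lemma M_A: "x \<in> A \<Longrightarrow> M x \<in> A"
  by (simp add: M_def A_add N_A)

lemma Npow_A: "x \<in> A \<Longrightarrow> (N ^^ k) x \<in> A"
  by (induction k) (auto intro: N_A)

lemma word_value_A: "set w \<subseteq> A \<Longrightarrow> word_value M w \<in> A"
  by (induction w) (auto intro: A_zero A_add M_A)

lemma V_subset: "V j \<subseteq> A"
  by (auto simp: V_def)

lemma V_subgroup:
  shows "0 \<in> V j" "x \<in> V j \<Longrightarrow> y \<in> V j \<Longrightarrow> x + y \<in> V j"
    "x \<in> V j \<Longrightarrow> y \<in> V j \<Longrightarrow> x - y \<in> V j" "x \<in> V j \<Longrightarrow> - x \<in> V j"
  by (auto simp: V_def A_zero A_add A_diff A_uminus Npow.zero Npow.add Npow.diff Npow.minus)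

lemma N_V: "x \<in> V (Suc j) \<Longrightarrow> N x \<in> V j"
  by (simp add: V_def N_A funpow_swap1)

lemma Npow_zero_mono: "(N ^^ i) x = 0 \<Longrightarrow> i \<le> j \<Longrightarrow> (N ^^ j) x = 0"
  using funpow_add[of "j - i" i N] by (simp add: Npow.zero)

lemma V_mono: "i \<le> j \<Longrightarrow> V i \<subseteq> V j"
  by (auto simp: V_def intro: Npow_zero_mono)

lemma Npow_M: "(N ^^ j) (M x) = (N ^^ j) x + (N ^^ Suc j) x"
  by (simp add: M_def Npow.add funpow_swap1)

lemma M_V: "x \<in> V j \<Longrightarrow> M x \<in> V j"
  by (auto simp: V_def M_A Npow_M Npow_zero_mono simp del: funpow.simps)

lemma psi_Npow_nonzero:
  assumes "x \<in> A" "(N ^^ Suc i) x = 0" "(N ^^ i) x \<noteq> 0"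
  shows "\<psi> ((N ^^ i) x) \<noteq> 0"
  using psi_inj[OF Npow_A[OF assms(1)], of i] assms(2,3) by auto

text \<open>The image of \<open>V (Suc i)\<close> under \<open>\<psi>\<close> after
  \<open>N ^^ i\<close> is a nonzero subgroup of the integers, generated by some \<open>t\<close>;
  dividing by \<open>t\<close> makes the functional surjective.\<close>

lemma functional:
  assumes "i < n"
  shows "\<exists>\<phi> t. t > 0 \<and> (\<forall>x\<in>V (Suc i). \<psi> ((N ^^ i) x) = t * \<phi> x) \<and> (\<forall>z. \<exists>x\<in>V (Suc i). \<phi> x = z)"
proof -
  define H where "H = (\<lambda>x. \<psi> ((N ^^ i) x)) ` V (Suc i)"
  have diff: "x - y \<in> H" if "x \<in> H" "y \<in> H" for x y
    using that V_subgroup(3) unfolding H_def image_iff by (metis Npow.diff psi.diff)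
  obtain x0 where x0: "x0 \<in> A" "(N ^^ (n - 1)) x0 \<noteq> 0" using N_index by blast
  \<comment> \<open>An element of \<open>V (Suc i)\<close> outside \<open>V i\<close>, which makes
    the image nonzero.\<close>
  define x where "x = (N ^^ (n - 1 - i)) x0"
  have "(N ^^ i) x = (N ^^ (n - 1)) x0"
    using assms funpow_add[of i "n - 1 - i" N] by (simp add: x_def)
  moreover have "(N ^^ Suc i) x = (N ^^ n) x0"
    using assms funpow_add[of "Suc i" "n - 1 - i" N] by (simp add: x_def)
  ultimately have x: "x \<in> A" "(N ^^ Suc i) x = 0" "(N ^^ i) x \<noteq> 0"
    using x0 N_nilpotent[of x0] Npow_A[of x0] by (auto simp: x_def)
  then have "\<psi> ((N ^^ i) x) \<in> H" "\<psi> ((N ^^ i) x) \<noteq> 0"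
    using psi_Npow_nonzero[OF x] by (auto simp: H_def V_def)
  from int_subgroup_principal[OF diff this] obtain t where t: "t > 0" "H = range (\<lambda>z. t * z)"
    by blast
  define \<phi> where "\<phi> x = \<psi> ((N ^^ i) x) div t" for x
  have 1: "\<psi> ((N ^^ i) x) = t * \<phi> x" if "x \<in> V (Suc i)" for x
  proof -
    have "\<psi> ((N ^^ i) x) \<in> H" using that by (auto simp: H_def)
    then obtain z where "\<psi> ((N ^^ i) x) = t * z" using t by auto
    then show ?thesis using t(1) by (simp add: \<phi>_def)
  qed
  have "\<exists>x\<in>V (Suc i). \<phi> x = z" for z
  proof -
    have "t * z \<in> H" using t by auto
    then obtain x where "x \<in> V (Suc i)" "t * z = \<psi> ((N ^^ i) x)" unfolding H_def by auto
    then show ?thesis using t(1) by (intro bexI[of _ x]) (simp_all add: \<phi>_def flip: \<open>t * z = _\<close>)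
  qed
  with 1 t(1) show ?thesis by blast
qed

context
  fixes i t :: _ and \<phi>
  assumes t: "t > (0 :: int)" and \<phi>: "\<And>x. x \<in> V (Suc i) \<Longrightarrow> \<psi> ((N ^^ i) x) = t * \<phi> x"
begin

lemma layer_functional: "layer M (V (Suc i)) \<phi>"
proof
  fix x y assume x: "x \<in> V (Suc i)"
  have "(N ^^ i) (M x) = (N ^^ i) x" using x by (simp only: Npow_M) (simp add: V_def)
  then have "t * \<phi> (M x) = t * \<phi> x" using \<phi>[OF M_V[OF x]] \<phi>[OF x] by metis
  then show "\<phi> (M x) = \<phi> x" using t by simp
  assume y: "y \<in> V (Suc i)"
  have "t * \<phi> (x + y) = t * (\<phi> x + \<phi> y)"
    using \<phi>[OF V_subgroup(2)[OF x y]] \<phi>[OF x] \<phi>[OF y]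
    by (simp add: Npow.add psi.add algebra_simps)
  then show "\<phi> (x + y) = \<phi> x + \<phi> y" using t by simp
qed (auto intro: V_subgroup M_V)

lemma functional_kernel: "{x \<in> V (Suc i). \<phi> x = 0} = V i"
proof -
  have "x \<in> V i" if "x \<in> V (Suc i)" "\<phi> x = 0" for x
    using psi_Npow_nonzero[of x i] \<phi>[OF that(1)] that by (auto simp: V_def)
  moreover have "\<phi> x = 0" if "x \<in> V i" for x
    using \<phi>[of x] V_mono[of i "Suc i"] that t by (auto simp: V_def psi.zero)
  ultimately show ?thesis using V_mono[of i "Suc i"] by auto
qed

end

text \<open>Induction on the nilpotency order of \<open>x\<close>: if \<open>M y = N x\<close>, then
  \<open>M (x - y) = x + N x - N x = x\<close>.\<close>

lemma M_surj:
  assumes "x \<in> A"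
  shows "\<exists>y\<in>A. M y = x"
proof -
  have "\<exists>y\<in>A. M y = x" if "x \<in> A" "(N ^^ k) x = 0" for k x
    using that
  proof (induction k arbitrary: x)
    case 0
    then show ?case using A_zero M.zero by auto
  next
    case (Suc k)
    have "N x \<in> A" "(N ^^ k) (N x) = 0" using Suc.prems by (auto simp: N_A funpow_swap1)
    with Suc.IH obtain y where y: "y \<in> A" "M y = N x" by blast
    have "M (x - y) = x" by (simp only: M.diff y) (simp add: M_def)
    then show ?case using A_diff[OF Suc.prems(1) y(1)] by blast
  qed
  from this[OF assms N_nilpotent[OF assms]] show ?thesis .
qed

lemma Mpow_surj: "x \<in> A \<Longrightarrow> \<exists>y\<in>A. (M ^^ k) y = x"
proof (induction k)
  case (Suc k)
  then show ?case using M_surj by (metis comp_apply funpow_Suc_right)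
qed auto

text \<open>The binomial expansion of \<open>(1 + N) ^ l\<close> to first order, since
  \<open>N ^^ Suc (Suc a)\<close> kills \<open>x\<close>. Hence \<open>1 - M ^ l\<close> acts on the
  layer as \<open>- l\<close> times \<open>N\<close>.\<close>

lemma Mpow_minus_id:
  assumes "(N ^^ Suc (Suc a)) x = 0"
  shows "(N ^^ Suc a) ((M ^^ l) x) = (N ^^ Suc a) x \<and> 
    \<psi> ((N ^^ a) ((M ^^ l) x)) = \<psi> ((N ^^ a) x) + int l * \<psi> ((N ^^ Suc a) x)"
proof -
  have "(N ^^ Suc (Suc a)) ((M ^^ l) x) = 0 \<and> (N ^^ Suc a) ((M ^^ l) x) = (N ^^ Suc a) x \<and>
    \<psi> ((N ^^ a) ((M ^^ l) x)) = \<psi> ((N ^^ a) x) + int l * \<psi> ((N ^^ Suc a) x)"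
  proof (induction l)
    case (Suc l)
    have M: "(N ^^ j) ((M ^^ Suc l) x) = (N ^^ j) ((M ^^ l) x) + (N ^^ Suc j) ((M ^^ l) x)" for j
      using Npow_M[of j "(M ^^ l) x"] by simp
    have 3: "(N ^^ Suc (Suc (Suc a))) ((M ^^ l) x) = 0"
      using Npow_zero_mono[of "Suc (Suc a)" _ "Suc (Suc (Suc a))"] Suc.IH by (simp del: funpow.simps)
    show ?case
      unfolding M 3 using Suc.IH by (simp add: psi.add algebra_simps del: funpow.simps)
  qed (use assms in \<open>simp_all del: funpow.simps(2)\<close>)
  then show ?thesis by blast
qed

end

section \<open>Thue--Morse words and the descent through the filtration\<close>

primrec thue_morse :: "'a \<Rightarrow> 'a \<Rightarrow> nat \<Rightarrow> 'a list" where
  "thue_morse x y 0 = [x]"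
| "thue_morse x y (Suc k) = thue_morse x y k @ thue_morse y x k"

lemma length_thue_morse: "length (thue_morse x y k) = 2 ^ k"
  by (induction k arbitrary: x y) auto

lemma set_thue_morse: "set (thue_morse x y k) \<subseteq> {x, y}"
proof (induction k arbitrary: x y)
  case (Suc k)
  show ?case using Suc[of x y] Suc[of y x] by auto
qed auto

lemma thue_morse_count_swap:
  "count_list (thue_morse x y (Suc k)) c = count_list (thue_morse y x (Suc k)) c"
  by simp

lemma thue_morse_mem: "x \<in> set (thue_morse x y k)"
  by (induction k) auto

context unipotent_lattice
begin

text \<open>
  Each Thue--Morse step multiplies the difference of the two values by \<open>1 - M ^ (2 ^ k)\<close>, hence
  pushes it one layer down the filtration \<open>V\<close> without annihilating it.
\<close>
lemma thue_morse_difference: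
  fixes x y :: 'a
  defines "\<Delta> k \<equiv> word_value M (thue_morse x y k) - word_value M (thue_morse y x k)"
  assumes "x \<in> A" "y \<in> A" "\<psi> ((N ^^ (n - 1)) (x - y)) \<noteq> 0" "k < n"
  shows "(N ^^ (n - k)) (\<Delta> k) = 0 \<and> \<psi> ((N ^^ (n - 1 - k)) (\<Delta> k)) \<noteq> 0"
  using assms(5)
proof (induction k)
  case 0
  then show ?case using N_nilpotent[OF A_diff[OF assms(2,3)]] assms(4)
    by (simp add: \<Delta>_def M.zero)
next
  case (Suc k)
  define a where "a = n - 1 - Suc k"
  have a: "n - k = Suc (Suc a)" "n - 1 - k = Suc a" "n - Suc k = Suc a"
    using Suc.prems by (auto simp: a_def)
  have \<Delta>: "\<Delta> (Suc k) = \<Delta> k - (M ^^ (2 ^ k)) (\<Delta> k)"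
    using additive.diff[OF additive_funpow[OF M.additive_axioms]]
    by (simp add: \<Delta>_def word_value_append[OF M.additive_axioms] length_thue_morse algebra_simps)
  have IH: "(N ^^ Suc (Suc a)) (\<Delta> k) = 0" "\<psi> ((N ^^ Suc a) (\<Delta> k)) \<noteq> 0"
    using Suc unfolding a by auto
  note P = Mpow_minus_id[OF IH(1), of "2 ^ k"]
  have "(N ^^ Suc a) (\<Delta> (Suc k)) = 0"
    unfolding \<Delta> Npow.diff using P by (simp only: diff_self)
  moreover have "\<psi> ((N ^^ a) (\<Delta> (Suc k))) = - (int (2 ^ k) * \<psi> ((N ^^ Suc a) (\<Delta> k)))"
    unfolding \<Delta> Npow.diff psi.diff using P by linarith
  ultimately show ?case
    using IH(2) unfolding a(3) by (simp add: a_def del: funpow.simps)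
qed

text \<open>A common tail \<open>q\<close> turns the Thue--Morse words \<open>?p\<close> and
  \<open>?p'\<close> into loops with equal counts of \<open>x\<close> but different
  \<open>\<phi>\<close>-values. These yield a loop whose value is not divisible by its count of
  \<open>x\<close>, so \<open>x\<close> can be split.\<close>

lemma extend_digits:
  assumes i: "Suc i < n - 1"
    and D: "D \<subseteq> A" "covers M A D (V (Suc i))"
    and d: "x \<in> D" "y \<in> D" "(N ^^ (n - 1)) x \<noteq> (N ^^ (n - 1)) y"
  shows "\<exists>e\<in>V (Suc i). \<exists>e'\<in>V (Suc i).
    covers M A (insert (x + e) (insert (x + e') (D - {x}))) (V i)"
proof -
  have "i < n" using i by simp
  from functional[OF this] obtain \<phi> t where t: "t > 0"
    and \<phi>: "\<And>x. x \<in> V (Suc i) \<Longrightarrow> \<psi> ((N ^^ i) x) = t * \<phi> x"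
    and onto: "\<And>z. \<exists>x\<in>V (Suc i). \<phi> x = z"
    by (elim exE conjE) (rule that, auto)
  interpret layer M "V (Suc i)" \<phi> by (rule layer_functional[OF t \<phi>])
  have kernel: "{z \<in> V (Suc i). \<phi> z = 0} = V i"
    using functional_kernel[of t i \<phi>] t \<phi> by blast
  have xy: "x \<in> A" "y \<in> A" using d D by auto
  have "\<psi> ((N ^^ (n - 1)) (x - y)) \<noteq> 0"
  proof (rule psi_Npow_nonzero[OF A_diff[OF xy]])
    show "(N ^^ Suc (n - 1)) (x - y) = 0"
      using N_nilpotent[OF A_diff[OF xy]] n by (simp del: funpow.simps)
  qed (use d(3) in \<open>simp add: Npow.diff\<close>)
  note difference = thue_morse_difference[OF xy this]
  define k where "k = n - 1 - i"
  \<comment> \<open>For \<open>k > 0\<close> swapping \<open>x\<close> and \<open>y\<close>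
    preserves the letter counts; for single letters it would not.\<close>
  obtain l where l: "k = Suc l" using i by (cases k) (auto simp: k_def)
  have k: "k < n" "n - k = Suc i" "n - 1 - k = i" using i by (auto simp: k_def)
  let ?p = "thue_morse x y k" and ?p' = "thue_morse y x k"
  define \<Delta> where "\<Delta> = val ?p - val ?p'"
  have p: "set ?p \<subseteq> D" "set ?p' \<subseteq> D" using set_thue_morse[of x y k] set_thue_morse[of y x k] d by auto
  have vals: "val ?p \<in> A" "val ?p' \<in> A" using p D(1) by (auto intro!: word_value_A)
  have \<Delta>: "\<Delta> \<in> V (Suc i)" "\<psi> ((N ^^ i) \<Delta>) \<noteq> 0"
    using difference[OF k(1)] A_diff[OF vals] unfolding k V_def \<Delta>_def by blast+
  then have \<Delta>_phi: "\<phi> \<Delta> \<noteq> 0" using \<phi>[of \<Delta>] by auto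
  \<comment> \<open>A tail of value exactly \<open>z\<close> would cancel \<open>?p\<close>. The
    tail \<open>q\<close> represents \<open>z\<close> modulo \<open>V (Suc i)\<close>, and serves
    \<open>?p'\<close> as well because both words have the same length.\<close>
  obtain z where z: "z \<in> A" "(M ^^ length ?p) z = - val ?p"
    using Mpow_surj[OF A_uminus[OF vals(1)]] by blast
  obtain q where q: "set q \<subseteq> D" "val q - z \<in> V (Suc i)"
    using D(2) z(1) by (auto simp: covers_def)
  have eq: "val (?p @ q) = (M ^^ length ?p) (val q - z)"
    using additive.diff[OF additive_funpow[OF M.additive_axioms]] z(2)
    by (simp add: val_append)
  have w: "val (?p @ q) \<in> V (Suc i)"
    unfolding eq by (rule funpow_M(1)[OF q(2)])
  have eq': "val (?p @ q) = val (?p' @ q) + \<Delta>"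
    by (simp add: val_append \<Delta>_def length_thue_morse)
  then have w': "val (?p' @ q) \<in> V (Suc i)" 
    using V_subgroup(3)[OF w \<Delta>(1)] by simp
  have ne: "\<phi> (val (?p @ q)) \<noteq> \<phi> (val (?p' @ q))"
    using phi_add[OF w' \<Delta>(1)] \<Delta>_phi eq' by simp
  have loops: "loop D (\<phi> (val (?p @ q))) (?p @ q)" "loop D (\<phi> (val (?p' @ q))) (?p' @ q)"
    using w w' p q(1) by (auto simp: loop_def)
  have count: "count_list (?p' @ q) x = count_list (?p @ q) x"
    unfolding l count_list_append by (simp only: thue_morse_count_swap[of y x])
  have mem: "x \<in> set (?p @ q)" "x \<in> set (?p' @ q)"
    using thue_morse_mem[of x] by (auto simp: l)
  \<comment> \<open>The loop with the smaller value is the one to be repeated, so both orders are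
    considered.\<close>
  obtain h u where u: "loop D h u" "x \<in> set u" "\<not> int (count_list u x) dvd h"
    using ne loop_not_dvd_count[OF loops _ count mem(2)]
      loop_not_dvd_count[OF loops(2,1) _ count[symmetric] mem(1)] by (meson linorder_neqE)
  show ?thesis using covers_split_digit[OF D(2) onto u(1,3,2)] unfolding kernel .
qed

text \<open>The digits satisfy \<open>\<phi> d = - 1\<close>, \<open>\<phi> d' = 1\<close> and
  \<open>d + d' = e\<close>. The one-letter words are loops for the top layer;
  \<open>[d, d']\<close> and \<open>[d', d]\<close>, with values \<open>e + N d'\<close> and
  \<open>e + N d\<close>, are loops for the next.\<close>

lemma two_digits:
  "\<exists>d\<in>A. \<exists>d'\<in>A. (N ^^ (n - 1)) d \<noteq> (N ^^ (n - 1)) d' \<and> covers M A {d, d'} (V (n - 2))"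
proof -
  have Suc_n: "Suc (n - 1) = n" "Suc (n - 2) = n - 1" using n by auto
  have "n - 1 < n" "n - 2 < n" using n by auto
  note functionals = this[THEN functional, unfolded Suc_n]
  from functionals(1) obtain \<phi> t where t: "t > 0" and \<phi>: "\<And>x. x \<in> V n \<Longrightarrow> \<psi> ((N ^^ (n - 1)) x) = t * \<phi> x"
    and onto: "\<And>z. \<exists>x\<in>V n. \<phi> x = z"
    by (elim exE conjE) (rule that, auto)
  from functionals(2) obtain \<theta> s where s: "s > 0" and \<theta>: "\<And>x. x \<in> V (n - 1) \<Longrightarrow> \<psi> ((N ^^ (n - 2)) x) = s * \<theta> x"
    and onto': "\<And>z. \<exists>x\<in>V (n - 1). \<theta> x = z"
    by (elim exE conjE) (rule that, auto)
  interpret top: layer M "V n" \<phi>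
    using layer_functional[of t "n - 1" \<phi>] t \<phi> unfolding Suc_n by blast
  interpret sub: layer M "V (n - 1)" \<theta>
    using layer_functional[of s "n - 2" \<theta>] s \<theta> unfolding Suc_n by blast
  have kernel: "{x \<in> V n. \<phi> x = 0} = V (n - 1)"
    using functional_kernel[of t "n - 1" \<phi>] t \<phi> unfolding Suc_n by blast
  have kernel': "{x \<in> V (n - 1). \<theta> x = 0} = V (n - 2)"
    using functional_kernel[of s "n - 2" \<theta>] s \<theta> unfolding Suc_n by blast
  have N_sub: "N x \<in> V (n - 1)" if "x \<in> A" for x
    using N_V[of x "n - 1"] that unfolding Suc_n V_n .
  \<comment> \<open>Thus \<open>\<theta>\<close> after \<open>N\<close> is a positive rational
    multiple of \<open>\<phi>\<close>: it is negative at \<open>d\<close> and opposite at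
    \<open>d'\<close>.\<close>
  have relate: "s * \<theta> (N x) = t * \<phi> x" if "x \<in> A" for x
    using \<theta>[OF N_sub[OF that]] \<phi>[of x] that funpow_swap1[of N "n - 2" x] unfolding V_n
    by (metis Suc_n(2) comp_apply funpow.simps(2))
  obtain d where d: "d \<in> A" "\<phi> d = - 1" using onto V_n by metis
  define \<mu> where "\<mu> = \<theta> (N d)"
  have "s * \<mu> < 0" using relate[OF d(1)] d(2) t by (simp add: \<mu>_def)
  then have \<mu>: "\<mu> < 0" using s by (simp add: mult_less_0_iff)
  \<comment> \<open>The two words then have \<open>\<theta>\<close>-values
    \<open>(\<mu> + 1) - \<mu> = 1\<close> and \<open>2 * \<mu> + 1 < 0\<close>.\<close>
  obtain e where e: "e \<in> V (n - 1)" "\<theta> e = \<mu> + 1" using onto' by blast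
  define d' where "d' = e - d"
  have e_A: "e \<in> A" using e V_subset by auto
  have d'_A: "d' \<in> A" by (simp add: d'_def A_diff e_A d(1))
  have "\<phi> (d' + d) = \<phi> d' + \<phi> d" using d d'_A V_n by (intro top.phi_add) auto
  moreover have "\<phi> e = 0" using e kernel by blast
  ultimately have \<phi>_d': "\<phi> d' = 1" using d(2) by (simp add: d'_def)
  have "s * \<theta> (N d') = - (s * \<theta> (N d))"
    using relate[OF d(1)] relate[OF d'_A] d(2) \<phi>_d' by simp
  then have \<theta>_d': "\<theta> (N d') = - \<mu>" using s by (simp add: \<mu>_def flip: mult_minus_right)
  have "covers M A {d, d'} (V n)"
    unfolding covers_def V_n using d d'_A
    by (intro ballI exI[of _ "[d]"]) (auto intro: A_diff simp: M.zero)
  moreover have "top.loop {d, d'} 1 [d']" "top.loop {d, d'} (- 1) [d]"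
    unfolding top.loop_def unfolding V_n using d d'_A \<phi>_d' by (auto simp: M.zero)
  ultimately have "covers M A {d, d'} (V (n - 1))"
    using top.covers_kernel[of A "{d, d'}"] unfolding kernel by fastforce
  moreover have "sub.loop {d, d'} 1 [d, d']"
  proof -
    have "word_value M [d, d'] = e + N d'" by (simp add: M.zero d'_def M_def[of "e - d"])
    then show ?thesis
      unfolding sub.loop_def using sub.phi_add[OF e(1) N_sub[OF d'_A]] sub.U_add[OF e(1) N_sub[OF d'_A]] e(2) \<theta>_d'
      by (simp del: word_value.simps)
  qed
  moreover have "sub.loop {d, d'} (2 * \<mu> + 1) [d', d]"
  proof -
    have "word_value M [d', d] = e + N d" by (simp add: M.zero M_def[of d] d'_def)
    then show ?thesis
      unfolding sub.loop_def using sub.phi_add[OF e(1) N_sub[OF d(1)]] sub.U_add[OF e(1) N_sub[OF d(1)]] e(2)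
      by (simp add: \<mu>_def del: word_value.simps)
  qed
  ultimately have "covers M A {d, d'} (V (n - 2))"
    using sub.covers_kernel[of A "{d, d'}"] \<mu> unfolding kernel' by fastforce
  moreover have "(N ^^ (n - 1)) d \<noteq> (N ^^ (n - 1)) d'"
    using \<phi>[of d] \<phi>[of d'] d d'_A \<phi>_d' t by (auto simp: V_n)
  ultimately show ?thesis using d(1) d'_A by blast
qed

text \<open>Each split adds at most one digit. The induction also carries two digits with different
  images under \<open>N ^^ (n - 1)\<close>, from which the next Thue--Morse words are built.\<close>

lemma covers_filtration:
  assumes "i \<le> n - 2"
  shows "\<exists>D. finite D \<and> D \<subseteq> A \<and> card D \<le> n - i \<and>
    (\<exists>x\<in>D. \<exists>y\<in>D. (N ^^ (n - 1)) x \<noteq> (N ^^ (n - 1)) y) \<and> covers M A D (V i)"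
  using assms
proof (induction i rule: inc_induct)
  case base
  obtain d d' where *: "d \<in> A" "d' \<in> A" "(N ^^ (n - 1)) d \<noteq> (N ^^ (n - 1)) d'"
    "covers M A {d, d'} (V (n - 2))" using two_digits by blast
  have "card {d, d'} \<le> n - (n - 2)" using n by (simp add: card_insert_if)
  with * show ?case by (intro exI[of _ "{d, d'}"]) auto
next
  case (step i)
  then obtain D x y where D: "finite D" "D \<subseteq> A" "card D \<le> n - Suc i" "covers M A D (V (Suc i))"
    and xy: "x \<in> D" "y \<in> D" "(N ^^ (n - 1)) x \<noteq> (N ^^ (n - 1)) y" by blast
  have i: "Suc i < n - 1" using step.hyps by simp
  obtain e e' where e: "e \<in> V (Suc i)" "e' \<in> V (Suc i)"
    "covers M A (insert (x + e) (insert (x + e') (D - {x}))) (V i)"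
    using extend_digits[OF i D(2,4) xy] by blast
  let ?D = "insert (x + e) (insert (x + e') (D - {x}))"
  have "e \<in> A" "e' \<in> A" using e V_subset by auto
  then have sub: "?D \<subseteq> A" using D(2) xy(1) A_add by auto
  have "card ?D \<le> Suc (Suc (card (D - {x})))"
    using D(1) by (simp add: card_insert_if)
  also have "\<dots> = Suc (card D)" using card_Suc_Diff1[OF D(1) xy(1)] by simp
  also have "\<dots> \<le> n - i" using D(3) i by simp
  finally have card: "card ?D \<le> n - i" .
  \<comment> \<open>The shift lies in \<open>V (Suc i)\<close>, hence in \<open>V (n - 1)\<close>,
    and leaves the top image unchanged.\<close>
  have "(N ^^ (n - 1)) (x + e) = (N ^^ (n - 1)) x"
    using e(1) i using Npow_zero_mono[of "Suc i" e "n - 1"] by (simp add: Npow.add V_def del: funpow.simps)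
  then have "(N ^^ (n - 1)) (x + e) \<noteq> (N ^^ (n - 1)) y" using xy(3) by simp
  moreover have "y \<in> ?D" using xy by auto
  ultimately have "\<exists>x\<in>?D. \<exists>y\<in>?D. (N ^^ (n - 1)) x \<noteq> (N ^^ (n - 1)) y" by blast
  with sub card e(3) D(1) show ?case by (intro exI[of _ ?D]) simp
qed

lemma covers_all:
  "\<exists>D. finite D \<and> D \<subseteq> A \<and> card D \<le> n \<and> (\<forall>v\<in>A. \<exists>w. w \<noteq> [] \<and> set w \<subseteq> D \<and> word_value M w = v)"
  using covers_filtration[of 0] unfolding covers_def V_def by fastforce

end

subsection \<open>Matrices similar to a Jordan block\<close>

lemma word_value_sum:
  assumes "additive M"
  shows "word_value M w = (\<Sum>l<length w. (M ^^ l) (w ! l))"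
proof (induction w rule: rev_induct)
  case (snoc x w)
  interpret additive M by fact
  have "(\<Sum>l<length w. (M ^^ l) ((w @ [x]) ! l)) = (\<Sum>l<length w. (M ^^ l) (w ! l))"
    by (rule sum.cong) (auto simp: nth_append)
  then show ?case by (simp add: word_value_append[OF assms] snoc zero)
qed simp

lemma index_mult_mat_sum:
  assumes "A \<in> carrier_mat n n" "B \<in> carrier_mat n n" "i < n" "k < n"
  shows "(A * B) $$ (i, k) = (\<Sum>j<n. A $$ (i, j) * B $$ (j, k))"
  using assms by (auto simp: scalar_prod_def atLeast0LessThan intro!: sum.cong)

text \<open>Pads a digit set of at most \<open>n\<close> elements to exactly \<open>n\<close>;
  existing representations survive.\<close>

lemma superset_with_card:
  assumes "finite D" "D \<subseteq> C" "card D \<le> n" "infinite C"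
  shows "\<exists>E. finite E \<and> D \<subseteq> E \<and> E \<subseteq> C \<and> card E = n"
proof -
  have "infinite (C - D)" using assms(1,4) by (rule Diff_infinite_finite)
  then obtain B where B: "finite B" "card B = n - card D" "B \<subseteq> C - D"
    using infinite_arbitrarily_large by blast
  then have "card (D \<union> B) = card D + card B" using assms(1) by (intro card_Un_disjoint) auto
  then show ?thesis using B assms by (intro exI[of _ "D \<union> B"]) auto
qed

lemma infinite_carrier_vec:
  assumes "n > 0"
  shows "infinite (carrier_vec n :: int vec set)"
proof -
  have "inj (\<lambda>z :: int. vec n (\<lambda>_. z))"
  proof (rule injI)
    fix x y :: int assume "vec n (\<lambda>_. x) = vec n (\<lambda>_. y)"
    then have "vec n (\<lambda>_. x) $ 0 = vec n (\<lambda>_. y) $ 0" by simp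
    then show "x = y" using assms by simp
  qed
  then have "infinite (range (\<lambda>z :: int. vec n (\<lambda>_. z)))"
    using finite_imageD infinite_UNIV_int by blast
  then show ?thesis by (rule infinite_super[rotated]) auto
qed

text \<open>
  Integer vectors are encoded as finitely supported functions because, unlike \<open>int vec\<close>, the
  type \<open>nat \<Rightarrow> int\<close> is an instance of \<open>ab_group_add\<close>.
\<close>
definition supported :: "nat \<Rightarrow> (nat \<Rightarrow> int) set" where
  "supported n = {f. \<forall>i\<ge>n. f i = 0}"

definition nil_part :: "nat \<Rightarrow> int mat \<Rightarrow> (nat \<Rightarrow> int) \<Rightarrow> nat \<Rightarrow> int" where
  "nil_part n M f = (\<lambda>i. if i < n then (\<Sum>j<n. M $$ (i, j) * f j) - f i else 0)"

lemma nil_part_supported: "nil_part n M f \<in> supported n"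
  by (simp add: nil_part_def supported_def)

text \<open>
  \<open>y\<close> below is the coordinate vector with respect to the rational Jordan basis, in which
  \<open>N\<close> is the shift.
\<close>
lemma unipotent_lattice_of_jordan:
  assumes n: "2 \<le> n" and M: "M \<in> carrier_mat n n" and sim: "rat_similar_to_jordan n M"
  shows "\<exists>i. unipotent_lattice (supported n) (nil_part n M) (\<lambda>f. f i) n"
proof -
  let ?M = "map_mat rat_of_int M" and ?J = "jordan_block n (1 :: rat)"
  obtain P Q where "similar_mat_wit ?M ?J P Q"
    using sim by (auto simp: rat_similar_to_jordan_def similar_mat_def)
  then have PQ: "P \<in> carrier_mat n n" "Q \<in> carrier_mat n n" "P * Q = 1\<^sub>m n" "Q * P = 1\<^sub>m n"
    and MPQ: "?M = P * ?J * Q"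
    using M by (auto simp: similar_mat_wit_def Let_def)
  have M': "?M \<in> carrier_mat n n" using M by simp
  have "Q * ?M = Q * (P * (?J * Q))"
    unfolding MPQ using PQ by (simp add: assoc_mult_mat[of _ n n _ n _ n])
  also have "\<dots> = Q * P * (?J * Q)"
    using PQ by (intro assoc_mult_mat[symmetric, of _ n n _ n _ n]) (auto intro!: mult_carrier_mat)
  also have "\<dots> = ?J * Q" using PQ by (simp add: left_mult_one_mat[of _ n n] mult_carrier_mat[of _ n n])
  \<comment> \<open>\<open>Q\<close> intertwines \<open>M\<close> with the Jordan block, so
    \<open>Q\<close> gives the Jordan coordinates \<open>y\<close>.\<close>
  finally have QM: "Q * ?M = ?J * Q" .
  have PQ_sum: "(\<Sum>j<n. P $$ (i, j) * Q $$ (j, k)) = (if i = k then 1 else 0)"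
    and QP_sum: "(\<Sum>j<n. Q $$ (i, j) * P $$ (j, k)) = (if i = k then 1 else 0)"
    if "i < n" "k < n" for i k
    using index_mult_mat_sum[OF PQ(1,2) that] index_mult_mat_sum[OF PQ(2,1) that] PQ(3,4) that
    by simp_all
  have QM_sum: "(\<Sum>j<n. Q $$ (i, j) * rat_of_int (M $$ (j, k))) =
      Q $$ (i, k) + (if Suc i < n then Q $$ (Suc i, k) else 0)" if "i < n" "k < n" for i k
  proof -
    have "(\<Sum>j<n. Q $$ (i, j) * rat_of_int (M $$ (j, k))) = (Q * ?M) $$ (i, k)"
      unfolding index_mult_mat_sum[OF PQ(2) M' that] using M that by (intro sum.cong) auto
    also have "\<dots> = (\<Sum>j<n. ?J $$ (i, j) * Q $$ (j, k))"
      unfolding QM using index_mult_mat_sum[OF jordan_block_carrier PQ(2) that] .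
    also have "\<dots> = (\<Sum>j<n. (if j = i then Q $$ (j, k) else 0) + (if j = Suc i then Q $$ (j, k) else 0))"
      using that by (intro sum.cong) auto
    also have "\<dots> = Q $$ (i, k) + (if Suc i < n then Q $$ (Suc i, k) else 0)"
      using that by (simp add: sum.distrib)
    finally show ?thesis .
  qed
  define y where "y f i = (\<Sum>j<n. Q $$ (i, j) * rat_of_int (f j))" for f i
  let ?N = "nil_part n M"
  have y_N: "y (?N f) i = (if Suc i < n then y f (Suc i) else 0)" if "i < n" for f i
  proof -
    have "y (?N f) i = (\<Sum>j<n. \<Sum>k<n. Q $$ (i, j) * rat_of_int (M $$ (j, k)) * rat_of_int (f k)) - y f i"
      by (simp add: y_def nil_part_def sum_subtractf algebra_simps sum_distrib_left)
    also have "(\<Sum>j<n. \<Sum>k<n. Q $$ (i, j) * rat_of_int (M $$ (j, k)) * rat_of_int (f k)) =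
        (\<Sum>k<n. (\<Sum>j<n. Q $$ (i, j) * rat_of_int (M $$ (j, k))) * rat_of_int (f k))"
      by (subst sum.swap) (simp add: sum_distrib_right)
    also have "\<dots> = (\<Sum>k<n. Q $$ (i, k) * rat_of_int (f k) +
        (if Suc i < n then Q $$ (Suc i, k) * rat_of_int (f k) else 0))"
      using that by (intro sum.cong) (auto simp: QM_sum algebra_simps)
    also have "\<dots> = y f i + (if Suc i < n then y f (Suc i) else 0)"
      by (simp add: y_def sum.distrib)
    finally show ?thesis by simp
  qed
  have y_Npow: "y ((?N ^^ k) f) i = (if i + k < n then y f (i + k) else 0)" if "i < n" for f i k
    using that
  proof (induction k arbitrary: i)
    case (Suc k)
    show ?case
    proof (cases "Suc i < n")
      case True
      then show ?thesis using y_N[OF Suc.prems] Suc.IH[OF True] by simp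
    qed (use y_N[OF Suc.prems] in auto)
  qed simp
  have y_inverse: "rat_of_int (f i) = (\<Sum>j<n. P $$ (i, j) * y f j)" if "i < n" for f i
  proof -
    have "(\<Sum>j<n. P $$ (i, j) * y f j) = (\<Sum>j<n. \<Sum>k<n. P $$ (i, j) * Q $$ (j, k) * rat_of_int (f k))"
      by (simp add: y_def sum_distrib_left mult.assoc)
    also have "\<dots> = (\<Sum>k<n. (\<Sum>j<n. P $$ (i, j) * Q $$ (j, k)) * rat_of_int (f k))"
      by (subst sum.swap) (simp add: sum_distrib_right)
    also have "\<dots> = (\<Sum>k<n. if i = k then rat_of_int (f k) else 0)"
      using that by (intro sum.cong) (auto simp: PQ_sum)
    also have "\<dots> = rat_of_int (f i)" using that by simp
    finally show ?thesis by simp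
  qed
  have y_zero: "f = 0" if "f \<in> supported n" "\<And>i. i < n \<Longrightarrow> y f i = 0" for f
  proof
    fix i show "f i = 0 i"
      using that y_inverse[of i f] by (cases "i < n") (auto simp: supported_def)
  qed
  have Npow_supported: "(?N ^^ k) f \<in> supported n" if "f \<in> supported n" for f k
    by (induction k) (use that in \<open>auto intro: nil_part_supported\<close>)
  \<comment> \<open>On the kernel of \<open>N\<close> only the Jordan coordinate \<open>0\<close>
    survives, so there \<open>f p = P $$ (p, 0) * y f 0\<close>; coordinate \<open>p\<close> serves
    as \<open>\<psi>\<close>.\<close>
  obtain p where p: "p < n" "P $$ (p, 0) \<noteq> 0"
    using QP_sum[of 0 0] n by (metis (no_types, lifting) gr0I lessThan_iff mult_zero_right not_numeral_le_zero sum.neutral zero_neq_one)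
  \<comment> \<open>The \<open>q\<close>-th unit vector has nonzero last Jordan coordinate, which
    \<open>N ^^ (n - 1)\<close> moves to position \<open>0\<close>.\<close>
  obtain q where q: "q < n" "Q $$ (n - 1, q) \<noteq> 0"
    using QP_sum[of "n - 1" "n - 1"] n
    by (metis (no_types, lifting) Suc_1 Suc_diff_1 diff_less lessI lessThan_iff less_le_trans mult_zero_left not_gr_zero not_numeral_le_zero sum.neutral zero_neq_one)
  have "unipotent_lattice (supported n) ?N (\<lambda>f. f p) n"
  proof
    fix f assume f: "f \<in> supported n"
    show "(?N ^^ n) f = 0"
      using Npow_supported[OF f] by (rule y_zero) (simp add: y_Npow)
    assume "?N f = 0" "f p = 0"
    have y0: "y f i = 0" if "0 < i" "i < n" for i
      using y_N[of "i - 1" f] that \<open>?N f = 0\<close> by (simp add: y_def)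
    have "(\<Sum>j<n. if j = 0 then P $$ (p, j) * y f j else 0) = (\<Sum>j<n. P $$ (p, j) * y f j)"
      by (rule sum.cong) (auto simp: y0)
    also have "\<dots> = 0" using y_inverse[OF p(1), of f] \<open>f p = 0\<close> by simp
    finally have "(\<Sum>j<n. if j = 0 then P $$ (p, j) * y f j else 0) = 0" .
    then have "y f 0 = 0" using p(2) n by simp
    with y0 have "y f i = 0" if "i < n" for i using that by (cases "i = 0") auto
    with f show "f = 0" by (rule y_zero)
  next
    let ?f = "\<lambda>j. if j = q then 1 else 0 :: int"
    have "y ?f (n - 1) = (\<Sum>j<n. if j = q then Q $$ (n - 1, j) else 0)"
      unfolding y_def by (rule sum.cong) auto
    then have "y ?f (n - 1) \<noteq> 0" using q by simp
    then have "y ((?N ^^ (n - 1)) ?f) 0 \<noteq> 0" using y_Npow[of 0 "n - 1" ?f] n by simp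
    then have "(?N ^^ (n - 1)) ?f \<noteq> 0" by (auto simp: y_def)
    moreover have "?f \<in> supported n" using q by (auto simp: supported_def)
    ultimately show "\<exists>f\<in>supported n. (?N ^^ (n - 1)) f \<noteq> 0" by blast
  qed (use n in \<open>auto simp: supported_def nil_part_def fun_eq_iff algebra_simps sum.distrib\<close>)
  then show ?thesis by blast
qed

lemma jordan_digits:
  assumes n: "2 \<le> n" and M: "M \<in> carrier_mat n n" and sim: "rat_similar_to_jordan n M"
  shows "\<exists>D. digit_set n D \<and> card D = n \<and> full_number_system n M D"
proof -
  obtain p where "unipotent_lattice (supported n) (nil_part n M) (\<lambda>f. f p) n"
    using unipotent_lattice_of_jordan[OF assms] by blast
  then interpret L: unipotent_lattice "supported n" "nil_part n M" "\<lambda>f. f p" n .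
  have vec_M: "vec n (L.M f) = M *\<^sub>v vec n f" for f
    using M by (intro eq_vecI) (auto simp: L.M_def nil_part_def scalar_prod_def atLeast0LessThan intro!: sum.cong)
  have vec_Mpow: "vec n ((L.M ^^ l) f) = M ^\<^sub>m l *\<^sub>v vec n f" for l f
  proof (induction l arbitrary: f)
    case (Suc l)
    have "vec n ((L.M ^^ Suc l) f) = vec n ((L.M ^^ l) (L.M f))" by (simp add: funpow_swap1)
    also have "\<dots> = M ^\<^sub>m l *\<^sub>v (M *\<^sub>v vec n f)" by (simp only: Suc vec_M)
    also have "\<dots> = M ^\<^sub>m Suc l *\<^sub>v vec n f"
      using assoc_mult_mat_vec[OF pow_carrier_mat[OF M] M, of "vec n f" l] by simp
    finally show ?case .
  qed (use M in auto)
  obtain D where D: "finite D" "card D \<le> n"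
    and words: "\<And>f. f \<in> supported n \<Longrightarrow> \<exists>w. w \<noteq> [] \<and> set w \<subseteq> D \<and> word_value L.M w = f"
    using L.covers_all by blast
  have "finite (vec n ` D)" "vec n ` D \<subseteq> carrier_vec n" "card (vec n ` D) \<le> n"
    using D card_image_le[OF D(1), of "vec n"] by auto
  then obtain E where E: "finite E" "vec n ` D \<subseteq> E" "E \<subseteq> carrier_vec n" "card E = n"
    using superset_with_card infinite_carrier_vec[of n] n by (metis not_gr_zero not_numeral_le_zero)
  have "has_representation n M E v" if v: "v \<in> carrier_vec n" for v
  proof -
    have "(\<lambda>i. if i < n then v $ i else 0) \<in> supported n" by (simp add: supported_def)
    from words[OF this] obtain w where w: "w \<noteq> []" "set w \<subseteq> D"
      "word_value L.M w = (\<lambda>i. if i < n then v $ i else 0)" by blast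
    \<comment> \<open>Index of the last digit; \<open>w \<noteq> []\<close> makes
      \<open>{..k}\<close> exactly the positions of \<open>w\<close>.\<close>
    define k where "k = length w - 1"
    have k: "{..<length w} = {..k}" using w(1) by (cases w) (auto simp: k_def)
    have digit: "vec n (w ! l) \<in> E" if "l \<le> k" for l
    proof -
      have "l < length w" using that k by auto
      then show ?thesis using w(2) E(2) nth_mem by blast
    qed
    have "v = finsum_vec TYPE(int) n (\<lambda>l. M ^\<^sub>m l *\<^sub>v vec n (w ! l)) {..k}" (is "v = ?s")
    proof (rule eq_vecI)
      have closed: "(\<lambda>l. M ^\<^sub>m l *\<^sub>v vec n (w ! l)) \<in> {..k} \<rightarrow> carrier_vec n"
        using M by (auto intro!: mult_mat_vec_carrier[of _ n n] pow_carrier_mat)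
      then have "?s \<in> carrier_vec n" by (rule finsum_vec_closed)
      then show "dim_vec v = dim_vec ?s" using v by simp
      fix i assume "i < dim_vec ?s"
      then have i: "i < n" using \<open>?s \<in> carrier_vec n\<close> by simp
      interpret coord: additive "\<lambda>f :: nat \<Rightarrow> int. f i" by unfold_locales simp
      have "v $ i = word_value L.M w i" using w(3) i by simp
      also have "\<dots> = (\<Sum>l\<le>k. (L.M ^^ l) (w ! l) i)"
        unfolding word_value_sum[OF L.M.additive_axioms] k by (rule coord.sum)
      also have "\<dots> = (\<Sum>l\<le>k. vec n ((L.M ^^ l) (w ! l)) $ i)" using i by simp
      also have "\<dots> = ?s $ i"
        unfolding vec_Mpow using closed i by (intro index_finsum_vec[symmetric]) auto
      finally show "v $ i = ?s $ i" .
    qed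
    then show ?thesis
      unfolding has_representation_def using digit by (intro exI[of _ k] exI[of _ "\<lambda>l. vec n (w ! l)"]) simp
  qed
  then show ?thesis
    using E by (intro exI[of _ E]) (auto simp: digit_set_def full_number_system_def)
qed

subsection \<open>Tightness\<close>

text \<open>\<open>X\<close> collects the digits occurring an odd number of times, toggling
  membership at each occurrence. It is independent of \<open>f\<close>, so it handles all
  coordinates simultaneously.\<close>

lemma odd_support:
  fixes a :: "nat \<Rightarrow> 'd"
  assumes "a ` {..k} \<subseteq> D" "finite D"
  shows "\<exists>X\<subseteq>D. \<forall>f :: 'd \<Rightarrow> int. even ((\<Sum>i\<le>k. f (a i)) - sum f X)"
  using assms(1)
proof (induction k)
  case 0
  then show ?case by (intro exI[of _ "{a 0}"]) auto
next
  case (Suc k)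
  then have "a ` {..k} \<subseteq> D" by auto
  from Suc.IH[OF this] obtain X where X: "X \<subseteq> D" "\<And>f :: 'd \<Rightarrow> int. even ((\<Sum>i\<le>k. f (a i)) - sum f X)" by auto
  let ?d = "a (Suc k)"
  have fin: "finite X" using X(1) assms(2) finite_subset by blast
  show ?case
  proof (cases "?d \<in> X")
    case True
    have "even ((\<Sum>i\<le>Suc k. f (a i)) - sum f (X - {?d}))" for f :: "'d \<Rightarrow> int"
    proof -
      have "(\<Sum>i\<le>Suc k. f (a i)) - sum f (X - {?d}) = ((\<Sum>i\<le>k. f (a i)) - sum f X) + 2 * f ?d"
        using sum.remove[OF fin True, of f] by simp
      then show ?thesis using X(2)[of f] by (simp only: dvd_add dvd_triv_left)
    qed
    then show ?thesis using X(1) by (intro exI[of _ "X - {?d}"]) auto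
  next
    case False
    have "even ((\<Sum>i\<le>Suc k. f (a i)) - sum f (insert ?d X))" for f :: "'d \<Rightarrow> int"
    proof -
      have "(\<Sum>i\<le>Suc k. f (a i)) - sum f (insert ?d X) = (\<Sum>i\<le>k. f (a i)) - sum f X"
        using sum.insert[OF fin False, of f] by simp
      then show ?thesis using X(2)[of f] by (simp only:)
    qed
    then show ?thesis using X(1) Suc.prems by (intro exI[of _ "insert ?d X"]) auto
  qed
qed

text \<open>The superdiagonal entries \<open>2\<close> make the matrix the identity modulo
  \<open>2\<close>.\<close>

definition tight_mat :: "nat \<Rightarrow> int mat" where
  "tight_mat n = mat n n (\<lambda>(i, j). if i = j then 1 else if Suc i = j then 2 else 0)"

lemma tight_mat_carrier: "tight_mat n \<in> carrier_mat n n"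
  by (simp add: tight_mat_def)

text \<open>Conjugation by diagonal powers of \<open>2\<close> scales entry \<open>(i, j)\<close> by
  \<open>2 ^ j / 2 ^ i\<close>, which doubles the superdiagonal.\<close>

lemma tight_mat_similar: "rat_similar_to_jordan n (tight_mat n)"
proof -
  let ?P = "mat_diag n (\<lambda>i. (1 / 2) ^ i :: rat)" and ?Q = "mat_diag n (\<lambda>i. 2 ^ i :: rat)"
  have inv: "(1 / 2) ^ i * 2 ^ i = (1 :: rat)" "2 ^ i * (1 / 2) ^ i = (1 :: rat)" for i :: nat
    by (simp_all flip: power_mult_distrib)
  show ?thesis
    unfolding rat_similar_to_jordan_def
  proof (rule similar_matI)
    show "{map_mat rat_of_int (tight_mat n), jordan_block n 1, ?P, ?Q} \<subseteq> carrier_mat n n"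
      by (simp add: tight_mat_carrier)
    show "?P * ?Q = 1\<^sub>m n" "?Q * ?P = 1\<^sub>m n"
      unfolding mat_diag_mult_left[OF mat_diag_dim]
      by (rule eq_matI; simp add: mat_diag_def inv)+
    show "map_mat rat_of_int (tight_mat n) = ?P * jordan_block n 1 * ?Q"
      unfolding mat_diag_mult_left[OF jordan_block_carrier]
      by (subst mat_diag_mult_right[of _ n])
        (auto simp: tight_mat_def inv power_divide intro!: eq_matI)
  qed
qed

lemma tight_mat_pow_parity:
  assumes "x \<in> carrier_vec n" "i < n"
  shows "even ((tight_mat n ^\<^sub>m k *\<^sub>v x) $ i - x $ i)"
  using assms(1)
proof (induction k arbitrary: x)
  case 0
  then show ?case using tight_mat_carrier by (simp add: tight_mat_def)
next
  case (Suc k)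
  have M: "tight_mat n \<in> carrier_mat n n" by (rule tight_mat_carrier)
  have 1: "even ((tight_mat n *\<^sub>v x) $ i - x $ i)"
  proof -
    have "(tight_mat n *\<^sub>v x) $ i - x $ i
        = (\<Sum>j<n. (if i = j then 1 else if Suc i = j then 2 else 0) * x $ j) - (\<Sum>j<n. if i = j then x $ j else 0)"
      using Suc.prems assms(2) by (simp add: tight_mat_def scalar_prod_def atLeast0LessThan)
    also have "\<dots> = (\<Sum>j<n. (if Suc i = j then 2 else 0) * x $ j)"
      unfolding sum_subtractf[symmetric] by (rule sum.cong) auto
    finally show ?thesis by (auto intro!: dvd_sum)
  qed
  have 2: "even ((tight_mat n ^\<^sub>m k *\<^sub>v (tight_mat n *\<^sub>v x)) $ i - (tight_mat n *\<^sub>v x) $ i)"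
    by (rule Suc.IH[OF mult_mat_vec_carrier[OF M Suc.prems]])
  have "tight_mat n ^\<^sub>m Suc k *\<^sub>v x = tight_mat n ^\<^sub>m k *\<^sub>v (tight_mat n *\<^sub>v x)"
    using assoc_mult_mat_vec[OF pow_carrier_mat[OF M] M Suc.prems] by simp
  then have *: "(tight_mat n ^\<^sub>m Suc k *\<^sub>v x) $ i - x $ i =
      ((tight_mat n *\<^sub>v x) $ i - x $ i) +
      ((tight_mat n ^\<^sub>m k *\<^sub>v (tight_mat n *\<^sub>v x)) $ i - (tight_mat n *\<^sub>v x) $ i)"
    by (simp del: index_mult_mat_vec)
  show ?case unfolding * by (rule dvd_add[OF 1 2])
qed

lemma tight_mat_digits:
  assumes "digit_set n D" "full_number_system n (tight_mat n) D"
  shows "n \<le> card D"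
proof -
  have D: "finite D" "D \<subseteq> carrier_vec n" using assms(1) by (auto simp: digit_set_def)
  have "\<exists>X\<subseteq>D. \<forall>i<n. i \<in> S \<longleftrightarrow> odd (\<Sum>d\<in>X. d $ i)" for S
  proof -
    let ?v = "vec n (\<lambda>i. if i \<in> S then 1 else 0 :: int)"
    have "has_representation n (tight_mat n) D ?v" using assms(2) by (simp add: full_number_system_def)
    then obtain k a where a: "\<And>i. i \<le> k \<Longrightarrow> a i \<in> D"
      and v: "?v = finsum_vec TYPE(int) n (\<lambda>i. (tight_mat n ^\<^sub>m i) *\<^sub>v a i) {..k}"
      unfolding has_representation_def by blast
    have a_c: "a i \<in> carrier_vec n" if "i \<le> k" for i using a[OF that] D(2) by auto
    have "a ` {..k} \<subseteq> D" using a by auto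
    from odd_support[OF this D(1)] obtain X
      where X: "X \<subseteq> D" "\<And>f :: int vec \<Rightarrow> int. even ((\<Sum>i\<le>k. f (a i)) - sum f X)"
      by (elim exE conjE) (rule that, auto)
    have "i \<in> S \<longleftrightarrow> odd (\<Sum>d\<in>X. d $ i)" if i: "i < n" for i
    proof -
      have "?v $ i = (\<Sum>l\<le>k. (tight_mat n ^\<^sub>m l *\<^sub>v a l) $ i)"
        unfolding v using a_c i
        by (intro index_finsum_vec)
          (auto intro!: mult_mat_vec_carrier[of _ n n] pow_carrier_mat tight_mat_carrier)
      then have "?v $ i - (\<Sum>l\<le>k. a l $ i) = (\<Sum>l\<le>k. (tight_mat n ^\<^sub>m l *\<^sub>v a l) $ i - a l $ i)"
        by (simp add: sum_subtractf)
      also have "even \<dots>" by (intro dvd_sum tight_mat_pow_parity a_c i) simp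
      finally have "even (?v $ i - (\<Sum>l\<le>k. a l $ i))" .
      from dvd_add[OF this X(2)[of "\<lambda>d. d $ i"]] have "even (?v $ i - (\<Sum>d\<in>X. d $ i))" by simp
      then show ?thesis using i by (simp split: if_splits)
    qed
    then show ?thesis using X(1) by blast
  qed
  then obtain X where X: "\<And>S. X S \<subseteq> D" "\<And>S i. i < n \<Longrightarrow> i \<in> S \<longleftrightarrow> odd (\<Sum>d\<in>X S. d $ i)"
    by metis
  \<comment> \<open>The coordinate parities of the sum over \<open>X S\<close> recover
    \<open>S\<close>, so \<open>D\<close> has at least \<open>2 ^ n\<close> subsets.\<close>
  have "inj_on X (Pow {..<n})"
  proof (rule inj_onI)
    fix S T assume ST: "S \<in> Pow {..<n}" "T \<in> Pow {..<n}" "X S = X T"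
    then have "i \<in> S \<longleftrightarrow> i \<in> T" if "i < n" for i using X(2)[OF that] by metis
    with ST show "S = T" by auto
  qed
  moreover have "X ` Pow {..<n} \<subseteq> Pow D" using X(1) by blast
  ultimately have "card (Pow {..<n}) \<le> card (Pow D)" using D(1) by (meson card_inj_on_le finite_Pow_iff)
  then show ?thesis using D(1) by (simp add: card_Pow)
qed

theorem theorem6p4:
  fixes n :: nat
  assumes "n \<ge> 2"
  shows "(\<forall>M \<in> carrier_mat n n. rat_similar_to_jordan n M \<longrightarrow>
            (\<exists>D. digit_set n D \<and> card D = n \<and> full_number_system n M D)) \<and>
         (\<exists>M \<in> carrier_mat n n. rat_similar_to_jordan n M \<and>
            (\<forall>D. digit_set n D \<and> card D < n \<longrightarrow> \<not> full_number_system n M D))"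
  using jordan_digits[OF assms] tight_mat_carrier tight_mat_similar tight_mat_digits
  by (meson leD)

end
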